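(* Let $R(z)$ be given by the stable representation $$R(z)=\delta+z\gamma_+(I_{\mathcal X_+}-z\alpha_+)^{-1}\beta_++\gamma_-(zI_{\mathcal X_-}-\alpha_-)^{-1}\beta_-$$ with $\alpha_-$ invertible, so that $R(0)=\delta-\gamma_-\alpha_-^{-1}\beta_-$, and let $\mathrm{Ricc}_1$, $\mathrm{Ricc}_2$, $\mathrm{Ricc}_2'$ be the associated solution sets (defined in the context). (a) If $R(0)$ is not invertible, then $\mathrm{Ricc}_2$ and $\mathrm{Ricc}_2'$ are empty, while $\mathrm{Ricc}_1$ might not be empty (that is, there exist stable representations with $\alpha_-$ invertible and $R(0)$ not invertible for which $\mathrm{Ricc}_1\neq\emptyset$). (b) If $R(0)$ is invertible, then $\mathrm{Ricc}_1=\mathrm{Ricc}_2'\subset\mathrm{Ricc}_2$, and the latter inclusion might be strict (that is, there exist stable representations with $\alpha_-$ and $R(0)$ invertible for which $\mathrm{Ricc}_2'\neq\mathrm{Ricc}_2$).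
   Context: $\mathcal B(\mathcal X,\mathcal Y)$ denotes bounded linear operators between Hilbert spaces; "invertible" means boundedly invertible. A stable representation of a $\mathcal B(\mathcal U)$-valued function $R$ is a formula as displayed in the claim, where $\mathcal U,\mathcal X_+,\mathcal X_-$ are complex Hilbert spaces, $\delta\in\mathcal B(\mathcal U)$, $\alpha_\pm\in\mathcal B(\mathcal X_\pm)$, $\beta_\pm\in\mathcal B(\mathcal U,\mathcal X_\pm)$, $\gamma_\pm\in\mathcal B(\mathcal X_\pm,\mathcal U)$, and the spectra of $\alpha_+$ and $\alpha_-$ are contained in the open unit disc. Given a stable representation with $\alpha_-$ invertible, consider the Riccati equations in $Q\in\mathcal B(\mathcal X_+,\mathcal X_-)$: $$\text{(I)}\quad Q=\alpha_-Q\alpha_++(\beta_--\alpha_-Q\beta_+)(\delta-\gamma_-Q\beta_+)^{-1}(\gamma_+-\gamma_-Q\alpha_+),$$ $$\text{(II)}\quad Q=\alpha_-Q\alpha_++(\beta_--\alpha_-Q\beta_+)(\delta-\gamma_-\alpha_-^{-1}\beta_-)^{-1}(\gamma_+-\gamma_-\alpha_-^{-1}Q).$$ For $Q$ to be a solution of (I) it is required that $\delta-\gamma_-Q\beta_+$ is invertible; for $Q$ to be a solution of (II) it is required that $\delta-\gamma_-\alpha_-^{-1}\beta_-$ is invertible. Define $\mathrm{Ricc}_1:=\{Q\in\mathcal B(\mathcal X_+,\mathcal X_-): Q\text{ solves (I)}\}$, $\mathrm{Ricc}_2:=\{Q\in\mathcal B(\mathcal X_+,\mathcal X_-): Q\text{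 solves (II)}\}$, $\mathrm{Ricc}_2':=\{Q\in\mathcal B(\mathcal X_+,\mathcal X_-): Q\text{ solves (II) and }\delta-\gamma_-Q\beta_+\text{ is invertible}\}$. *)

theory Defs
  imports "HOL-Analysis.Analysis"
begin

class scaleC =
  fixes scaleC :: "complex \<Rightarrow> 'a \<Rightarrow> 'a"  (infixr \<open>*\<^sub>C\<close> 75)

text \<open>Complex Hilbert spaces. Completeness and the norm topology come from \<^class>\<open>banach\<close>;
  the inner product is linear in its first argument and induces the norm. The zero space is allowed.\<close>

class complex_hilbert_space = banach + scaleC +
  fixes cinner :: "'a \<Rightarrow> 'a \<Rightarrow> complex"
  assumes scaleC_add_right: "c *\<^sub>C (x + y) = c *\<^sub>C x + c *\<^sub>C y"
    and scaleC_add_left: "(b + c) *\<^sub>C x = b *\<^sub>C x + c *\<^sub>C x"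
    and scaleC_scaleC: "b *\<^sub>C (c *\<^sub>C x) = (b * c) *\<^sub>C x"
    and scaleR_scaleC: "r *\<^sub>R x = complex_of_real r *\<^sub>C x"
    and cinner_commute: "cinner x y = cnj (cinner y x)"
    and cinner_add_left: "cinner (x + y) z = cinner x z + cinner y z"
    and cinner_scaleC_left: "cinner (c *\<^sub>C x) y = c * cinner x y"
    and cinner_eq_norm_square: "cinner x x = complex_of_real ((norm x)\<^sup>2)"

instantiation complex :: complex_hilbert_space
begin

definition scaleC_complex :: "complex \<Rightarrow> complex \<Rightarrow> complex"
  where "scaleC_complex c x = c * x"

definition cinner_complex :: "complex \<Rightarrow> complex \<Rightarrow> complex"
  where "cinner_complex x y = x * cnj y"

instance
  by standard
    (simp_all add: scaleC_complex_def cinner_complex_def algebra_simps scaleR_conv_of_real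
      complex_norm_square[symmetric] del: of_real_power)

end

lemma norm_scaleC: "norm (c *\<^sub>C x) = cmod c * norm x"
  for x :: "'a::complex_hilbert_space"
proof -
  have "cinner (c *\<^sub>C x) (c *\<^sub>C x) = c * cnj (c * cinner x x)"
    by (metis cinner_commute cinner_scaleC_left)
  also have "\<dots> = complex_of_real ((cmod c)\<^sup>2) * complex_of_real ((norm x)\<^sup>2)"
    by (simp add: cinner_eq_norm_square mult.assoc[symmetric] complex_norm_square[symmetric]
        del: of_real_power)
  finally have "complex_of_real ((norm (c *\<^sub>C x))\<^sup>2) = complex_of_real ((cmod c * norm x)\<^sup>2)"
    by (simp only: cinner_eq_norm_square of_real_mult power_mult_distrib)
  then have "(norm (c *\<^sub>C x))\<^sup>2 = (cmod c * norm x)\<^sup>2"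
    by (simp only: of_real_eq_iff)
  then show ?thesis by (simp add: power2_eq_iff_nonneg)
qed

lemma bounded_linear_scaleC: "bounded_linear (\<lambda>x::'a::complex_hilbert_space. c *\<^sub>C x)"
proof (rule bounded_linear_intro[where K = "cmod c"])
  show "c *\<^sub>C (r *\<^sub>R x) = r *\<^sub>R (c *\<^sub>C x)" for r and x :: 'a
    by (simp add: scaleR_scaleC scaleC_scaleC mult.commute)
qed (simp_all add: scaleC_add_right norm_scaleC mult.commute)

instantiation blinfun :: (real_normed_vector, complex_hilbert_space) scaleC
begin

lift_definition scaleC_blinfun :: "complex \<Rightarrow> 'a \<Rightarrow>\<^sub>L 'b \<Rightarrow> 'a \<Rightarrow>\<^sub>L 'b"
  is "\<lambda>c f x. c *\<^sub>C f x"
  by (rule bounded_linear_compose[OF bounded_linear_scaleC])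

instance ..

end

text \<open>The type \<open>'a \<Rightarrow>\<^sub>L 'b\<close> consists of the bounded \<^emph>\<open>real\<close>-linear maps; the space of bounded
  operators is cut out by complex homogeneity.\<close>

definition bounded_ops :: "('a::complex_hilbert_space \<Rightarrow>\<^sub>L 'b::complex_hilbert_space) set"
  where "bounded_ops = {T. \<forall>c x. blinfun_apply T (c *\<^sub>C x) = c *\<^sub>C blinfun_apply T x}"

definition op_invertible :: "('a::complex_hilbert_space \<Rightarrow>\<^sub>L 'b::complex_hilbert_space) \<Rightarrow> bool"
  where "op_invertible T \<longleftrightarrow>
    (\<exists>S \<in> bounded_ops. S o\<^sub>L T = id_blinfun \<and> T o\<^sub>L S = id_blinfun)"

text \<open>Only meaningful for invertible arguments, where the inverse is unique.\<close>

definition op_inverse ::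
    "('a::complex_hilbert_space \<Rightarrow>\<^sub>L 'b::complex_hilbert_space) \<Rightarrow> ('b \<Rightarrow>\<^sub>L 'a)"
  where "op_inverse T =
    (THE S. S \<in> bounded_ops \<and> S o\<^sub>L T = id_blinfun \<and> T o\<^sub>L S = id_blinfun)"

lemma op_inverse_eqI:
  assumes "S \<in> bounded_ops" "S o\<^sub>L T = id_blinfun" "T o\<^sub>L S = id_blinfun"
  shows "op_inverse T = S"
  unfolding op_inverse_def
proof (rule the_equality)
  fix S'
  assume S': "S' \<in> bounded_ops \<and> S' o\<^sub>L T = id_blinfun \<and> T o\<^sub>L S' = id_blinfun"
  have "S' o\<^sub>L (T o\<^sub>L S) = (S' o\<^sub>L T) o\<^sub>L S" by (simp add: blinfun_eqI)
  moreover have "S' o\<^sub>L id_blinfun = S'" "id_blinfun o\<^sub>L S = S" by (simp_all add: blinfun_eqI)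
  ultimately show "S' = S" using S' assms by simp
qed (use assms in blast)

definition op_spectrum :: "('a::complex_hilbert_space \<Rightarrow>\<^sub>L 'a) \<Rightarrow> complex set"
  where "op_spectrum T = {z. \<not> op_invertible (z *\<^sub>C id_blinfun - T)}"

text \<open>The data \<open>\<delta>, \<alpha>\<^sub>+, \<beta>\<^sub>+, \<gamma>\<^sub>+, \<alpha>\<^sub>-, \<beta>\<^sub>-, \<gamma>\<^sub>-\<close> of a representation; the suffixes \<open>p\<close> and \<open>m\<close>
  stand for the subscripts \<open>+\<close> and \<open>-\<close>. The type parameters are the spaces
  \<open>\<U>\<close>, \<open>\<X>\<^sub>+\<close> and \<open>\<X>\<^sub>-\<close>.\<close>

record (overloaded) ('u, 'p, 'm) representation =
  \<delta> :: "'u::complex_hilbert_space \<Rightarrow>\<^sub>L 'u"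
  \<alpha>p :: "'p::complex_hilbert_space \<Rightarrow>\<^sub>L 'p"
  \<beta>p :: "'u \<Rightarrow>\<^sub>L 'p"
  \<gamma>p :: "'p \<Rightarrow>\<^sub>L 'u"
  \<alpha>m :: "'m::complex_hilbert_space \<Rightarrow>\<^sub>L 'm"
  \<beta>m :: "'u \<Rightarrow>\<^sub>L 'm"
  \<gamma>m :: "'m \<Rightarrow>\<^sub>L 'u"

definition stable_representation ::
    "('u::complex_hilbert_space, 'p::complex_hilbert_space, 'm::complex_hilbert_space)
      representation \<Rightarrow> bool"
  where "stable_representation \<Sigma> \<longleftrightarrow>
    \<delta> \<Sigma> \<in> bounded_ops \<and>
    \<alpha>p \<Sigma> \<in> bounded_ops \<and> \<beta>p \<Sigma> \<in> bounded_ops \<and> \<gamma>p \<Sigma> \<in> bounded_ops \<and>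
    \<alpha>m \<Sigma> \<in> bounded_ops \<and> \<beta>m \<Sigma> \<in> bounded_ops \<and> \<gamma>m \<Sigma> \<in> bounded_ops \<and>
    op_spectrum (\<alpha>p \<Sigma>) \<subseteq> ball 0 1 \<and> op_spectrum (\<alpha>m \<Sigma>) \<subseteq> ball 0 1"

text \<open>The function \<open>R\<close>, meaningful at those \<open>z\<close> where both operators being inverted are
  invertible; for a stable representation with \<open>\<alpha>\<^sub>-\<close> invertible this includes \<open>z = 0\<close>.\<close>

definition transfer_function ::
    "('u::complex_hilbert_space, 'p::complex_hilbert_space, 'm::complex_hilbert_space)
      representation \<Rightarrow> complex \<Rightarrow> 'u \<Rightarrow>\<^sub>L 'u"
  where "transfer_function \<Sigma> z =
    \<delta> \<Sigma>
    + z *\<^sub>C (\<gamma>p \<Sigma> o\<^sub>L op_inverse (id_blinfun - z *\<^sub>C \<alpha>p \<Sigma>) o\<^sub>L \<beta>p \<Sigma>)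
    + (\<gamma>m \<Sigma> o\<^sub>L op_inverse (z *\<^sub>C id_blinfun - \<alpha>m \<Sigma>) o\<^sub>L \<beta>m \<Sigma>)"

definition solves_I ::
    "('u::complex_hilbert_space, 'p::complex_hilbert_space, 'm::complex_hilbert_space)
      representation \<Rightarrow> ('p \<Rightarrow>\<^sub>L 'm) \<Rightarrow> bool"
  where "solves_I \<Sigma> Q \<longleftrightarrow>
    op_invertible (\<delta> \<Sigma> - (\<gamma>m \<Sigma> o\<^sub>L Q o\<^sub>L \<beta>p \<Sigma>)) \<and>
    Q = (\<alpha>m \<Sigma> o\<^sub>L Q o\<^sub>L \<alpha>p \<Sigma>)
      + ((\<beta>m \<Sigma> - (\<alpha>m \<Sigma> o\<^sub>L Q o\<^sub>L \<beta>p \<Sigma>))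
          o\<^sub>L op_inverse (\<delta> \<Sigma> - (\<gamma>m \<Sigma> o\<^sub>L Q o\<^sub>L \<beta>p \<Sigma>))
          o\<^sub>L (\<gamma>p \<Sigma> - (\<gamma>m \<Sigma> o\<^sub>L Q o\<^sub>L \<alpha>p \<Sigma>)))"

definition solves_II ::
    "('u::complex_hilbert_space, 'p::complex_hilbert_space, 'm::complex_hilbert_space)
      representation \<Rightarrow> ('p \<Rightarrow>\<^sub>L 'm) \<Rightarrow> bool"
  where "solves_II \<Sigma> Q \<longleftrightarrow>
    op_invertible (\<delta> \<Sigma> - (\<gamma>m \<Sigma> o\<^sub>L op_inverse (\<alpha>m \<Sigma>) o\<^sub>L \<beta>m \<Sigma>)) \<and>
    Q = (\<alpha>m \<Sigma> o\<^sub>L Q o\<^sub>L \<alpha>p \<Sigma>)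
      + ((\<beta>m \<Sigma> - (\<alpha>m \<Sigma> o\<^sub>L Q o\<^sub>L \<beta>p \<Sigma>))
          o\<^sub>L op_inverse (\<delta> \<Sigma> - (\<gamma>m \<Sigma> o\<^sub>L op_inverse (\<alpha>m \<Sigma>) o\<^sub>L \<beta>m \<Sigma>))
          o\<^sub>L (\<gamma>p \<Sigma> - (\<gamma>m \<Sigma> o\<^sub>L op_inverse (\<alpha>m \<Sigma>) o\<^sub>L Q)))"

definition Ricc1 ::
    "('u::complex_hilbert_space, 'p::complex_hilbert_space, 'm::complex_hilbert_space)
      representation \<Rightarrow> ('p \<Rightarrow>\<^sub>L 'm) set"
  where "Ricc1 \<Sigma> = {Q \<in> bounded_ops. solves_I \<Sigma> Q}"

definition Ricc2 ::
    "('u::complex_hilbert_space, 'p::complex_hilbert_space, 'm::complex_hilbert_space)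
      representation \<Rightarrow> ('p \<Rightarrow>\<^sub>L 'm) set"
  where "Ricc2 \<Sigma> = {Q \<in> bounded_ops. solves_II \<Sigma> Q}"

definition Ricc2' ::
    "('u::complex_hilbert_space, 'p::complex_hilbert_space, 'm::complex_hilbert_space)
      representation \<Rightarrow> ('p \<Rightarrow>\<^sub>L 'm) set"
  where "Ricc2' \<Sigma> =
    {Q \<in> bounded_ops. solves_II \<Sigma> Q \<and> op_invertible (\<delta> \<Sigma> - (\<gamma>m \<Sigma> o\<^sub>L Q o\<^sub>L \<beta>p \<Sigma>))}"

end

theory Submission
  imports Defs
begin

text \<open>Write \<open>W = \<beta>\<^sub>- - \<alpha>\<^sub>- Q \<beta>\<^sub>+\<close> and compare the four operators
  \<open>D = \<delta> - \<gamma>\<^sub>- Q \<beta>\<^sub>+\<close>, \<open>V = \<gamma>\<^sub>+ - \<gamma>\<^sub>- Q \<alpha>\<^sub>+\<close>,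
  \<open>D\<^sub>0 = \<delta> - \<gamma>\<^sub>- \<alpha>\<^sub>-\<^sup>-\<^sup>1 \<beta>\<^sub>-\<close> and \<open>V\<^sub>0 = \<gamma>\<^sub>+ - \<gamma>\<^sub>- \<alpha>\<^sub>-\<^sup>-\<^sup>1 Q\<close>
  of the two Riccati equations, which read \<open>Q = \<alpha>\<^sub>- Q \<alpha>\<^sub>+ + W D\<^sup>-\<^sup>1 V\<close> and
  \<open>Q = \<alpha>\<^sub>- Q \<alpha>\<^sub>+ + W D\<^sub>0\<^sup>-\<^sup>1 V\<^sub>0\<close>. One has
  \<open>D - D\<^sub>0 = \<gamma>\<^sub>- \<alpha>\<^sub>-\<^sup>-\<^sup>1 W\<close>. Multiplying \<open>Q = \<alpha>\<^sub>- Q \<alpha>\<^sub>+ + W X\<close> from the left by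
  \<open>\<gamma>\<^sub>- \<alpha>\<^sub>-\<^sup>-\<^sup>1\<close> therefore gives \<open>V - V\<^sub>0 = (D - D\<^sub>0) X\<close>
  (\<open>riccati_difference\<close>). Hence \<open>D X = V\<close> if and only if \<open>D\<^sub>0 X = V\<^sub>0\<close>; when \<open>D\<close> and
  \<open>D\<^sub>0\<close> are both invertible, \<open>X = D\<^sup>-\<^sup>1 V\<close> and \<open>X = D\<^sub>0\<^sup>-\<^sup>1 V\<^sub>0\<close> are the same condition,
  and the two equations have the same solutions (\<open>solves_I_iff_solves_II\<close>).

  The operator \<open>D\<^sub>0\<close> is the value of the transfer function at \<open>0\<close>, so equation (II) has no
  solution unless that value is invertible. The two existence claims are witnessed by scalar
  representations, all of whose operators are multiplications by complex numbers.\<close>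

section \<open>Bounded operators and their inverses\<close>

lemma blinfun_compose_id [simp]: "T o\<^sub>L id_blinfun = T" "id_blinfun o\<^sub>L T = T"
  by (simp_all add: blinfun_eqI)

lemma blinfun_compose_assoc: "(R o\<^sub>L S) o\<^sub>L T = R o\<^sub>L (S o\<^sub>L T)"
  by (simp add: blinfun_eqI)

lemma blinfun_compose_uminus: "(- S) o\<^sub>L (- T) = S o\<^sub>L T"
  by (simp add: blinfun_eqI blinfun.bilinear_simps)

lemmas blinfun_compose_diff_left =
  bounded_bilinear.diff_left[OF bounded_bilinear_blinfun_compose]

lemma scaleC_zero_left [simp]: "0 *\<^sub>C x = 0"
  for x :: "'a::complex_hilbert_space"
  using norm_scaleC[of 0 x] by simp

lemma scaleC_minus_right: "c *\<^sub>C (- x) = - (c *\<^sub>C x)"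
  for x :: "'a::complex_hilbert_space"
  by (rule linear_neg[OF bounded_linear.linear[OF bounded_linear_scaleC]])

lemma scaleC_zero_left_blinfun [simp]: "0 *\<^sub>C T = 0"
  for T :: "'a::real_normed_vector \<Rightarrow>\<^sub>L 'b::complex_hilbert_space"
  by (simp add: blinfun_eqI scaleC_blinfun.rep_eq)

lemma bounded_ops_uminus: "T \<in> bounded_ops \<Longrightarrow> - T \<in> bounded_ops"
  by (simp add: bounded_ops_def uminus_blinfun.rep_eq scaleC_minus_right)

lemma op_inverse:
  assumes "op_invertible T"
  shows op_inverse_in_bounded_ops: "op_inverse T \<in> bounded_ops"
    and op_inverse_left: "op_inverse T o\<^sub>L T = id_blinfun"
    and op_inverse_right: "T o\<^sub>L op_inverse T = id_blinfun"
proof -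
  obtain S where S: "S \<in> bounded_ops" "S o\<^sub>L T = id_blinfun" "T o\<^sub>L S = id_blinfun"
    using assms unfolding op_invertible_def by blast
  then have "op_inverse T = S" by (rule op_inverse_eqI)
  with S show "op_inverse T \<in> bounded_ops" "op_inverse T o\<^sub>L T = id_blinfun"
    "T o\<^sub>L op_inverse T = id_blinfun" by simp_all
qed

lemma op_inverse_uminus:
  assumes "op_invertible T"
  shows "op_inverse (- T) = - op_inverse T"
  by (rule op_inverse_eqI)
    (simp_all add: blinfun_compose_uminus bounded_ops_uminus op_inverse[OF assms])

lemma op_inverse_compose_eq_iff:
  assumes "op_invertible T"
  shows "X = op_inverse T o\<^sub>L Y \<longleftrightarrow> T o\<^sub>L X = Y"
proof
  assume "X = op_inverse T o\<^sub>L Y"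
  then show "T o\<^sub>L X = Y"
    by (simp add: blinfun_compose_assoc[symmetric] op_inverse_right[OF assms])
next
  assume "T o\<^sub>L X = Y"
  then show "X = op_inverse T o\<^sub>L Y"
    by (auto simp: blinfun_compose_assoc[symmetric] op_inverse_left[OF assms])
qed

section \<open>Comparison of the two Riccati equations\<close>

lemma transfer_function_0:
  assumes "op_invertible (\<alpha>m \<Sigma>)"
  shows "transfer_function \<Sigma> 0 = \<delta> \<Sigma> - (\<gamma>m \<Sigma> o\<^sub>L op_inverse (\<alpha>m \<Sigma>) o\<^sub>L \<beta>m \<Sigma>)"
  by (simp add: transfer_function_def op_inverse_uminus[OF assms] blinfun_eqI
      blinfun.bilinear_simps)

text \<open>Here \<open>X\<close> is arbitrary, so that it can be instantiated by the last two factors of either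
  equation. The names \<open>cp\<close> and \<open>cm\<close> stand for \<open>\<gamma>\<^sub>+\<close> and \<open>\<gamma>\<^sub>-\<close>.\<close>

lemma riccati_difference:
  assumes inv: "op_invertible am"
    and Q: "Q = (am o\<^sub>L Q o\<^sub>L ap) + ((bm - (am o\<^sub>L Q o\<^sub>L bp)) o\<^sub>L X)"
  shows "(cp - (cm o\<^sub>L Q o\<^sub>L ap)) - (cp - (cm o\<^sub>L op_inverse am o\<^sub>L Q))
    = ((d - (cm o\<^sub>L Q o\<^sub>L bp)) - (d - (cm o\<^sub>L op_inverse am o\<^sub>L bm))) o\<^sub>L X"
proof (rule blinfun_eqI)
  have cancel: "blinfun_apply (op_inverse am) (blinfun_apply am y) = y" for y
    using op_inverse_left[OF inv] by (metis blinfun_apply_blinfun_compose blinfun_apply_id_blinfun)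
  fix x
  have "blinfun_apply (cm o\<^sub>L op_inverse am o\<^sub>L Q) x
    = blinfun_apply (cm o\<^sub>L op_inverse am) (blinfun_apply Q x)" by simp
  also have "\<dots> = blinfun_apply (cm o\<^sub>L op_inverse am)
      (blinfun_apply ((am o\<^sub>L Q o\<^sub>L ap) + ((bm - (am o\<^sub>L Q o\<^sub>L bp)) o\<^sub>L X)) x)"
    by (subst Q) (rule refl)
  finally show "blinfun_apply ((cp - (cm o\<^sub>L Q o\<^sub>L ap)) - (cp - (cm o\<^sub>L op_inverse am o\<^sub>L Q))) x
    = blinfun_apply (((d - (cm o\<^sub>L Q o\<^sub>L bp)) - (d - (cm o\<^sub>L op_inverse am o\<^sub>L bm))) o\<^sub>L X) x"
    by (simp add: blinfun.bilinear_simps cancel)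
qed

lemma solves_I_iff_solves_II:
  assumes am: "op_invertible (\<alpha>m \<Sigma>)"
    and D: "op_invertible (\<delta> \<Sigma> - (\<gamma>m \<Sigma> o\<^sub>L Q o\<^sub>L \<beta>p \<Sigma>))" (is "op_invertible ?D")
    and D0: "op_invertible (\<delta> \<Sigma> - (\<gamma>m \<Sigma> o\<^sub>L op_inverse (\<alpha>m \<Sigma>) o\<^sub>L \<beta>m \<Sigma>))"
      (is "op_invertible ?E")
  shows "solves_I \<Sigma> Q \<longleftrightarrow> solves_II \<Sigma> Q"
proof -
  let ?V = "\<gamma>p \<Sigma> - (\<gamma>m \<Sigma> o\<^sub>L Q o\<^sub>L \<alpha>p \<Sigma>)"
  let ?U = "\<gamma>p \<Sigma> - (\<gamma>m \<Sigma> o\<^sub>L op_inverse (\<alpha>m \<Sigma>) o\<^sub>L Q)"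
  let ?eq = "\<lambda>X. Q = (\<alpha>m \<Sigma> o\<^sub>L Q o\<^sub>L \<alpha>p \<Sigma>) + ((\<beta>m \<Sigma> - (\<alpha>m \<Sigma> o\<^sub>L Q o\<^sub>L \<beta>p \<Sigma>)) o\<^sub>L X)"
  have transfer: "X = op_inverse ?D o\<^sub>L ?V \<longleftrightarrow> X = op_inverse ?E o\<^sub>L ?U" if "?eq X" for X
  proof -
    have "?V - ?U = (?D o\<^sub>L X) - (?E o\<^sub>L X)"
      by (rule trans[OF riccati_difference[OF am that] blinfun_compose_diff_left])
    then have "?D o\<^sub>L X = ?V \<longleftrightarrow> ?E o\<^sub>L X = ?U"
      by (metis diff_left_imp_eq diff_add_cancel)
    then show ?thesis
      by (simp only: op_inverse_compose_eq_iff[OF D] op_inverse_compose_eq_iff[OF D0])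
  qed
  have "solves_I \<Sigma> Q \<longleftrightarrow> ?eq (op_inverse ?D o\<^sub>L ?V)"
    using D by (simp only: solves_I_def blinfun_compose_assoc simp_thms)
  moreover have "solves_II \<Sigma> Q \<longleftrightarrow> ?eq (op_inverse ?E o\<^sub>L ?U)"
    using D0 by (simp only: solves_II_def blinfun_compose_assoc simp_thms)
  ultimately show ?thesis using transfer by metis
qed

section \<open>Scalar operators\<close>

text \<open>Multiplication by \<open>c\<close> on the one-dimensional Hilbert space \<open>\<complex>\<close>; as a function of
  \<open>c\<close> it turns addition and composition of operators into complex arithmetic.\<close>

definition scalar_op :: "complex \<Rightarrow> complex \<Rightarrow>\<^sub>L complex"
  where "scalar_op c = c *\<^sub>C id_blinfun"

lemma scalar_op_apply [simp]: "blinfun_apply (scalar_op c) x = c * x"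
  by (simp add: scalar_op_def scaleC_blinfun.rep_eq scaleC_complex_def)

lemma scalar_op_eq_iff [simp]: "scalar_op a = scalar_op b \<longleftrightarrow> a = b"
  by (metis mult.right_neutral scalar_op_apply)

lemma scalar_op_arith [simp]:
  "scalar_op a + scalar_op b = scalar_op (a + b)"
  "scalar_op a - scalar_op b = scalar_op (a - b)"
  "scalar_op a o\<^sub>L scalar_op b = scalar_op (a * b)"
  by (rule blinfun_eqI; simp add: blinfun.bilinear_simps algebra_simps)+

lemma id_blinfun_eq_scalar_op: "id_blinfun = scalar_op 1"
  by (simp add: blinfun_eqI)

lemma scalar_op_in_bounded_ops [simp]: "scalar_op c \<in> bounded_ops"
  by (simp add: bounded_ops_def scaleC_complex_def)

lemma op_inverse_scalar_op [simp]:
  assumes "c \<noteq> 0"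
  shows "op_inverse (scalar_op c) = scalar_op (inverse c)"
  by (rule op_inverse_eqI) (simp_all add: id_blinfun_eq_scalar_op assms)

lemma op_invertible_scalar_op_iff [simp]: "op_invertible (scalar_op c) \<longleftrightarrow> c \<noteq> 0"
proof
  assume "op_invertible (scalar_op c)"
  then obtain S where "scalar_op c o\<^sub>L S = id_blinfun"
    unfolding op_invertible_def by blast
  then have "c * blinfun_apply S 1 = 1"
    by (metis blinfun_apply_blinfun_compose blinfun_apply_id_blinfun scalar_op_apply)
  then show "c \<noteq> 0" by auto
next
  assume "c \<noteq> 0"
  then show "op_invertible (scalar_op c)"
    unfolding op_invertible_def
    by (intro bexI[of _ "scalar_op (inverse c)"]) (simp_all add: id_blinfun_eq_scalar_op)
qed

lemma not_op_invertible_0_complex [simp]: "\<not> op_invertible (0 :: complex \<Rightarrow>\<^sub>L complex)"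
  using op_invertible_scalar_op_iff[of 0] by (simp add: scalar_op_def)

lemma op_spectrum_scalar_op [simp]: "op_spectrum (scalar_op c) = {c}"
  by (auto simp: op_spectrum_def scalar_op_def[symmetric])

section \<open>Solution sets and the value at zero\<close>

theorem proposition3p7:
  shows
    "(\<forall>\<Sigma> :: ('u::complex_hilbert_space, 'p::complex_hilbert_space, 'm::complex_hilbert_space)
          representation.
        stable_representation \<Sigma> \<and> op_invertible (\<alpha>m \<Sigma>) \<longrightarrow>
          transfer_function \<Sigma> 0 = \<delta> \<Sigma> - (\<gamma>m \<Sigma> o\<^sub>L op_inverse (\<alpha>m \<Sigma>) o\<^sub>L \<beta>m \<Sigma>) \<and>
          (\<not> op_invertible (transfer_function \<Sigma> 0) \<longrightarrow> Ricc2 \<Sigma> = {} \<and> Ricc2' \<Sigma> = {}) \<and>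
          (op_invertible (transfer_function \<Sigma> 0) \<longrightarrow> Ricc1 \<Sigma> = Ricc2' \<Sigma> \<and> Ricc2' \<Sigma> \<subseteq> Ricc2 \<Sigma>))
     \<and> (\<exists>\<Sigma> :: (complex, complex, complex) representation.
          stable_representation \<Sigma> \<and> op_invertible (\<alpha>m \<Sigma>) \<and>
          \<not> op_invertible (transfer_function \<Sigma> 0) \<and> Ricc1 \<Sigma> \<noteq> {})
     \<and> (\<exists>\<Sigma> :: (complex, complex, complex) representation.
          stable_representation \<Sigma> \<and> op_invertible (\<alpha>m \<Sigma>) \<and>
          op_invertible (transfer_function \<Sigma> 0) \<and> Ricc2' \<Sigma> \<noteq> Ricc2 \<Sigma>)"
proof (intro conjI allI impI)
  fix \<Sigma> :: "('u, 'p, 'm) representation"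
  assume "stable_representation \<Sigma> \<and> op_invertible (\<alpha>m \<Sigma>)"
  then have am: "op_invertible (\<alpha>m \<Sigma>)" by blast
  show R0: "transfer_function \<Sigma> 0 = \<delta> \<Sigma> - (\<gamma>m \<Sigma> o\<^sub>L op_inverse (\<alpha>m \<Sigma>) o\<^sub>L \<beta>m \<Sigma>)"
    using am by (rule transfer_function_0)
  show "Ricc2 \<Sigma> = {}" "Ricc2' \<Sigma> = {}" if "\<not> op_invertible (transfer_function \<Sigma> 0)"
    using that unfolding R0 by (simp_all add: Ricc2_def Ricc2'_def solves_II_def)
  show "Ricc1 \<Sigma> = Ricc2' \<Sigma>" if "op_invertible (transfer_function \<Sigma> 0)"
  proof -
    have "solves_I \<Sigma> Q \<longleftrightarrow>
        solves_II \<Sigma> Q \<and> op_invertible (\<delta> \<Sigma> - (\<gamma>m \<Sigma> o\<^sub>L Q o\<^sub>L \<beta>p \<Sigma>))" for Q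
      using solves_I_iff_solves_II[OF am _ that[unfolded R0]] solves_I_def by blast
    then show ?thesis by (simp add: Ricc1_def Ricc2'_def)
  qed
  show "Ricc2' \<Sigma> \<subseteq> Ricc2 \<Sigma>"
    by (auto simp: Ricc2_def Ricc2'_def)
next
  \<comment> \<open>As \<open>\<gamma>\<^sub>+ = 0\<close>, the zero operator solves (I) because \<open>\<delta> = 2\<close> is invertible, while
    \<open>R(0) = 2 - (1/2)\<^sup>-\<^sup>1 = 0\<close>.\<close>
  let ?\<Sigma> = "\<lparr>\<delta> = scalar_op 2, \<alpha>p = scalar_op 0, \<beta>p = scalar_op 0, \<gamma>p = scalar_op 0,
    \<alpha>m = scalar_op (1/2), \<beta>m = scalar_op 1, \<gamma>m = scalar_op 1\<rparr>"
  have "scalar_op 0 \<in> Ricc1 ?\<Sigma>"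
    by (simp add: Ricc1_def solves_I_def)
  then have "stable_representation ?\<Sigma> \<and> op_invertible (\<alpha>m ?\<Sigma>) \<and>
      \<not> op_invertible (transfer_function ?\<Sigma> 0) \<and> Ricc1 ?\<Sigma> \<noteq> {}"
    by (auto simp: stable_representation_def transfer_function_0)
  then show "\<exists>\<Sigma> :: (complex, complex, complex) representation.
      stable_representation \<Sigma> \<and> op_invertible (\<alpha>m \<Sigma>) \<and>
      \<not> op_invertible (transfer_function \<Sigma> 0) \<and> Ricc1 \<Sigma> \<noteq> {}"
    by (rule exI)
next
  \<comment> \<open>Here \<open>R(0) = 1\<close> and (II) reads \<open>Q = (- Q/2)(- 2 Q) = Q\<^sup>2\<close>; its solution \<open>Q = 1\<close>
    gives \<open>\<delta> - \<gamma>\<^sub>- Q \<beta>\<^sub>+ = 1 - Q = 0\<close>.\<close>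
  let ?\<Sigma> = "\<lparr>\<delta> = scalar_op 1, \<alpha>p = scalar_op 0, \<beta>p = scalar_op 1, \<gamma>p = scalar_op 0,
    \<alpha>m = scalar_op (1/2), \<beta>m = scalar_op 0, \<gamma>m = scalar_op 1\<rparr>"
  have "scalar_op 1 \<in> Ricc2 ?\<Sigma>" "scalar_op 1 \<notin> Ricc2' ?\<Sigma>"
    by (simp_all add: Ricc2_def Ricc2'_def solves_II_def)
  then have "stable_representation ?\<Sigma> \<and> op_invertible (\<alpha>m ?\<Sigma>) \<and>
      op_invertible (transfer_function ?\<Sigma> 0) \<and> Ricc2' ?\<Sigma> \<noteq> Ricc2 ?\<Sigma>"
    by (auto simp: stable_representation_def transfer_function_0)
  then show "\<exists>\<Sigma> :: (complex, complex, complex) representation.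
      stable_representation \<Sigma> \<and> op_invertible (\<alpha>m \<Sigma>) \<and>
      op_invertible (transfer_function \<Sigma> 0) \<and> Ricc2' \<Sigma> \<noteq> Ricc2 \<Sigma>"
    by (rule exI)
qed

end
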